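(* Let $g$ be a derivator, $h\in\operatorname{UC}_g([a,b],\mathbb R)$ and $t_1,t_2\in[a,b]_+$ with $t_1<_gt_2$. If $\int_{[t_1,t_2)^g}h\,d\mu_g=0$, then $h$ has a root (of type I or type II) in $[t_1,t_2)^g_+$.
   Context: A derivator is a left-continuous nondecreasing function $g:\mathbb R\to\mathbb R$; $\mu_g$ is the Lebesgue–Stieltjes measure with $\mu_g([c,d))=g(d)-g(c)$. $g(t^+)$ is the right-hand limit and $D_g=\{t\in\mathbb R:g(t^+)>g(t)\}$. For real $a<b$, $[a,b]_+$ is the disjoint union of $[a,b]$ and a formal copy $\{t^+:t\in D_g\cap[a,b)\}$; $g$ is extended to it by letting $g(t^+)$ be the right-hand limit of $g$ at $t$. $x<_gy$ means $g(x)<g(y)$. $\operatorname{UC}_g([a,b],\mathbb R)$ is the space of functions $f:[a,b]\to\mathbb R$ such that for every $\varepsilon>0$ there is $\delta>0$ with $|f(u)-f(v)|<\varepsilon$ whenever $u,v\in[a,b]$, $|g(u)-g(v)|<\delta$. Such $f$ is extended to $[a,b]_+$ by $f(t^+)=\lim_{y\to t^+}f(y)$ (which exists). $[x,y)^g=\{z\in[a,b]:g(x)\le g(z)<g(y)\}$ and $[x,y)^g_+=\{z\in[a,b]_+:g(x)\le g(z)<g(y)\}$. $f$ has a root of type I at $t\in[a,b]_+$ if $f(t)=0$, and a root of type II at $t$ if $t\in D_g\cap[a,b)$ and $f(t)f(t^+)<0$. *)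

theory Defs
  imports "HOL-Analysis.Analysis"
begin

definition derivator :: "(real \<Rightarrow> real) \<Rightarrow> bool" where
  "derivator g \<longleftrightarrow> mono g \<and> (\<forall>t. continuous (at_left t) g)"

text \<open>
  The library's \<open>interval_measure\<close> is generated by the intervals \<open>{c<..d}\<close> and needs a
  right-continuous function. Derivators are left-continuous, so the generating intervals
  here are \<open>{c..<d}\<close>.
\<close>

definition ls_measure :: "(real \<Rightarrow> real) \<Rightarrow> real measure" where
  "ls_measure g =
     extend_measure UNIV {(c, d). c \<le> d} (\<lambda>(c, d). {c..<d}) (\<lambda>(c, d). ennreal (g d - g c))"

definition right_lim :: "(real \<Rightarrow> real) \<Rightarrow> real \<Rightarrow> real" where
  "right_lim f t = Lim (at_right t) f"

definition jumps :: "(real \<Rightarrow> real) \<Rightarrow> real set" where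
  "jumps g = {t. right_lim g t > g t}"

text \<open>Points of the disjoint union: \<open>Pt t\<close> stands for \<open>t\<close> and \<open>PtPlus t\<close> for the formal copy \<open>t\<^sup>+\<close>.\<close>

datatype point = Pt real | PtPlus real

definition ivl_plus :: "(real \<Rightarrow> real) \<Rightarrow> real \<Rightarrow> real \<Rightarrow> point set" where
  "ivl_plus g a b = Pt ` {a..b} \<union> PtPlus ` (jumps g \<inter> {a..<b})"

fun ext_plus :: "(real \<Rightarrow> real) \<Rightarrow> point \<Rightarrow> real" where
  "ext_plus f (Pt t) = f t"
| "ext_plus f (PtPlus t) = right_lim f t"

definition less_g :: "(real \<Rightarrow> real) \<Rightarrow> point \<Rightarrow> point \<Rightarrow> bool" where
  "less_g g x y \<longleftrightarrow> ext_plus g x < ext_plus g y"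

text \<open>
  Functions on \<open>[a,b]\<close> are represented by total functions; only their values on \<open>{a..b}\<close>
  matter. In particular, for \<open>t \<in> {a..<b}\<close> the limit in \<open>ext_plus f (PtPlus t)\<close> depends only on
  the values of \<open>f\<close> on \<open>{a..b}\<close>.
\<close>

definition UC :: "(real \<Rightarrow> real) \<Rightarrow> real \<Rightarrow> real \<Rightarrow> (real \<Rightarrow> real) set" where
  "UC g a b = {f. \<forall>\<epsilon>>0. \<exists>\<delta>>0. \<forall>u\<in>{a..b}. \<forall>v\<in>{a..b}. \<bar>g u - g v\<bar> < \<delta> \<longrightarrow> \<bar>f u - f v\<bar> < \<epsilon>}"

definition ico :: "(real \<Rightarrow> real) \<Rightarrow> real \<Rightarrow> real \<Rightarrow> point \<Rightarrow> point \<Rightarrow> real set" where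
  "ico g a b x y = {z \<in> {a..b}. ext_plus g x \<le> g z \<and> g z < ext_plus g y}"

definition ico_plus :: "(real \<Rightarrow> real) \<Rightarrow> real \<Rightarrow> real \<Rightarrow> point \<Rightarrow> point \<Rightarrow> point set" where
  "ico_plus g a b x y = {z \<in> ivl_plus g a b. ext_plus g x \<le> ext_plus g z \<and> ext_plus g z < ext_plus g y}"

definition root_I :: "(real \<Rightarrow> real) \<Rightarrow> real \<Rightarrow> real \<Rightarrow> (real \<Rightarrow> real) \<Rightarrow> point \<Rightarrow> bool" where
  "root_I g a b f p \<longleftrightarrow> p \<in> ivl_plus g a b \<and> ext_plus f p = 0"

definition root_II :: "(real \<Rightarrow> real) \<Rightarrow> real \<Rightarrow> real \<Rightarrow> (real \<Rightarrow> real) \<Rightarrow> point \<Rightarrow> bool" where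
  "root_II g a b f p \<longleftrightarrow>
     (\<exists>t \<in> jumps g \<inter> {a..<b}. p = Pt t \<and> ext_plus f (Pt t) * ext_plus f (PtPlus t) < 0)"

text \<open>
  The definitions above use total functions (\<open>extend_measure\<close>, \<open>Lim\<close>, and the integral), which
  take default values when the intended object does not exist. The following facts show
  that these defaults never occur.
\<close>

lemma space_ls_measure [simp]: "space (ls_measure g) = UNIV"
  by (simp add: ls_measure_def space_extend_measure)

lemma sets_ls_measure [simp, measurable_cong]: "sets (ls_measure g) = sets borel"
proof -
  have "sets (ls_measure g) = sigma_sets UNIV ((\<lambda>(c, d). {c..<d}) ` {(c, d). c \<le> d})"
    unfolding ls_measure_def by (rule sets_extend_measure) auto
  also have "\<dots> = sigma_sets UNIV (range (\<lambda>(c, d). {c..<d::real}))"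
  proof -
    have "(\<lambda>(c, d). {c..<d}) ` {(c, d). c \<le> d} = range (\<lambda>(c, d). {c..<d::real})"
      apply (auto simp: image_iff)
      subgoal for c d by (rule exI[of _ c], rule exI[of _ "max c d"]) (auto simp: max_def)
      done
    then show ?thesis by simp
  qed
  also have "\<dots> = sets borel"
    by (subst borel_eq_atLeastLessThan) simp
  finally show ?thesis .
qed

lemma emeasure_ls_measure:
  assumes g: "derivator g" and "c \<le> d"
  shows "emeasure (ls_measure g) {c..<d} = ennreal (g d - g c)"
proof -
  define N where "N = distr (interval_measure (\<lambda>x. - g (- x))) borel uminus"
  have mono: "mono g" and lc: "\<And>t. continuous (at_left t) g"
    using g by (auto simp: derivator_def)
  have rc: "continuous (at_right s) (\<lambda>x. - g (- x))" for s
  proof -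
    have "filterlim g (nhds (g (-s))) (at_left (-s))"
      using lc[of "-s"] by (simp add: continuous_within)
    then have "((\<lambda>x. g (- x)) \<longlongrightarrow> g (- s)) (at_right s)"
      by (simp add: filterlim_at_left_to_right)
    then show ?thesis
      by (auto simp: continuous_within intro: tendsto_minus)
  qed
  have N: "emeasure N {i..<j} = ennreal (g j - g i)" if "i \<le> j" for i j
  proof -
    have "uminus -` {i..<j} = {-j<..-i}" by auto
    then have "emeasure N {i..<j} = emeasure (interval_measure (\<lambda>x. - g (- x))) {-j<..-i}"
      unfolding N_def by (subst emeasure_distr) auto
    also have "\<dots> = ennreal (g j - g i)"
      using that mono rc by (subst emeasure_interval_measure_Ioc) (auto simp: mono_def)
    finally show ?thesis .
  qed
  have "sets N = sets (ls_measure g)" by (simp add: N_def)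
  then have pos: "positive (sets (ls_measure g)) (emeasure N)"
    and ca: "countably_additive (sets (ls_measure g)) (emeasure N)"
    using emeasure_positive[of N] emeasure_countably_additive[of N] by auto
  show ?thesis
    by (rule emeasure_extend_measure_Pair[OF ls_measure_def, of "emeasure N"])
       (use pos ca N \<open>c \<le> d\<close> in auto)
qed

lemma tendsto_right_lim_derivator:
  assumes "derivator g"
  shows "(g \<longlongrightarrow> right_lim g t) (at_right t)"
proof -
  have mono: "mono g" using assms by (simp add: derivator_def)
  have "(g \<longlongrightarrow> Inf (g ` {t<..})) (at_right t)"
  proof (rule decreasing_tendsto)
    have bdd: "bdd_below (g ` {t<..})"
      by (rule bdd_belowI[of _ "g t"]) (use mono in \<open>auto simp: mono_def\<close>)
    show "\<forall>\<^sub>F n in at_right t. Inf (g ` {t<..}) \<le> g n"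
      using eventually_at_right_less[of t] by eventually_elim (auto intro: cInf_lower bdd)
    fix x assume "Inf (g ` {t<..}) < x"
    then obtain s where s: "s > t" "g s < x"
      using cInf_less_iff[of "g ` {t<..}" x] bdd by auto
    have "\<forall>\<^sub>F n in at_right t. n < s"
      using s(1) by (auto simp: eventually_at_right)
    then show "\<forall>\<^sub>F n in at_right t. g n < x"
      by eventually_elim (use s mono in \<open>auto simp: mono_def intro: le_less_trans[of _ "g s"]\<close>)
  qed
  then show ?thesis
    unfolding right_lim_def by (simp add: tendsto_Lim)
qed

lemma UC_factor:
  assumes "f \<in> UC g a b"
  obtains F where "uniformly_continuous_on (closure (g ` {a..b})) F"
    and "\<And>t. t \<in> {a..b} \<Longrightarrow> f t = F (g t)"
proof -
  define H where "H s = f (SOME t. t \<in> {a..b} \<and> g t = s)" for s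
  have H: "f t = H (g t)" if t: "t \<in> {a..b}" for t
  proof -
    define u where "u = (SOME u. u \<in> {a..b} \<and> g u = g t)"
    have u: "u \<in> {a..b} \<and> g u = g t" unfolding u_def by (rule someI[of _ t]) (use t in auto)
    have "\<bar>f u - f t\<bar> < \<epsilon>" if "\<epsilon> > 0" for \<epsilon>
      using assms that u t unfolding UC_def by fastforce
    then have "f u = f t" by (metis abs_le_zero_iff dense_ge eq_iff_diff_eq_0 less_imp_le)
    then show ?thesis by (simp add: H_def u_def)
  qed
  have "uniformly_continuous_on (g ` {a..b}) H"
    unfolding uniformly_continuous_on_def
  proof (intro allI impI)
    fix e :: real assume "e > 0"
    then obtain \<delta> where "\<delta> > 0"
      and \<delta>: "\<And>u v. u \<in> {a..b} \<Longrightarrow> v \<in> {a..b} \<Longrightarrow> \<bar>g u - g v\<bar> < \<delta> \<Longrightarrow> \<bar>f u - f v\<bar> < e"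
      using assms unfolding UC_def by blast
    then show "\<exists>d>0. \<forall>x\<in>g ` {a..b}. \<forall>x'\<in>g ` {a..b}. dist x' x < d \<longrightarrow> dist (H x') (H x) < e"
      by (intro exI[of _ \<delta>]) (auto simp: dist_real_def simp flip: H)
  qed
  from uniformly_continuous_on_extension_on_closure[OF this] obtain F where
    "uniformly_continuous_on (closure (g ` {a..b})) F" "\<And>x. x \<in> g ` {a..b} \<Longrightarrow> H x = F x"
    by metis
  then show ?thesis using that H by (metis image_eqI)
qed

lemma tendsto_right_lim_UC:
  assumes g: "derivator g" and f: "f \<in> UC g a b" and t: "a \<le> t" "t < b"
  shows "(f \<longlongrightarrow> right_lim f t) (at_right t)"
proof -
  obtain F where F: "uniformly_continuous_on (closure (g ` {a..b})) F"
    "\<And>t. t \<in> {a..b} \<Longrightarrow> f t = F (g t)"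
    using UC_factor[OF f] by blast
  have ev: "\<forall>\<^sub>F s in at_right t. s \<in> {a..b}"
    using t unfolding eventually_at_right[OF t(2)] by (intro exI[of _ b]) auto
  have lim: "(g \<longlongrightarrow> right_lim g t) (at_right t)"
    by (rule tendsto_right_lim_derivator[OF g])
  have ev': "\<forall>\<^sub>F s in at_right t. g s \<in> closure (g ` {a..b})"
    using ev by eventually_elim (meson closure_subset imageI subsetD)
  have "right_lim g t \<in> closure (g ` {a..b})"
    using Lim_in_closed_set[OF closed_closure ev' _ lim] by auto
  with continuous_on_tendsto_compose[OF uniformly_continuous_imp_continuous[OF F(1)] lim _ ev']
  have "((\<lambda>s. F (g s)) \<longlongrightarrow> F (right_lim g t)) (at_right t)" by auto
  moreover have "\<forall>\<^sub>F s in at_right t. F (g s) = f s"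
    using ev by eventually_elim (simp add: F(2))
  ultimately have "(f \<longlongrightarrow> F (right_lim g t)) (at_right t)"
    by (rule Lim_transform_eventually)
  then show ?thesis
    unfolding right_lim_def by (simp add: tendsto_Lim)
qed

lemma ico_borel:
  assumes "derivator g"
  shows "ico g a b x y \<in> sets borel"
proof -
  have [measurable]: "g \<in> borel_measurable borel"
    using assms by (intro borel_measurable_mono) (simp add: derivator_def)
  show ?thesis unfolding ico_def by measurable
qed

lemma set_integrable_UC:
  assumes g: "derivator g" and f: "f \<in> UC g a b"
  shows "set_integrable (ls_measure g) (ico g a b x y) f"
proof -
  obtain F where F: "uniformly_continuous_on (closure (g ` {a..b})) F"
    "\<And>t. t \<in> {a..b} \<Longrightarrow> f t = F (g t)"
    using UC_factor[OF f] by blast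
  have mono: "mono g" using g by (simp add: derivator_def)
  have [measurable]: "g \<in> borel_measurable borel"
    using mono by (rule borel_measurable_mono)
  let ?C = "closure (g ` {a..b})"
  have Fm: "(\<lambda>s. indicator ?C s *\<^sub>R F s) \<in> borel_measurable borel"
    by (rule borel_measurable_continuous_on_indicator)
       (auto intro: uniformly_continuous_imp_continuous F(1))
  have ico: "ico g a b x y \<in> sets borel" "ico g a b x y \<subseteq> {a..b}"
    using ico_borel[OF g] by (auto simp: ico_def)
  have "bounded (g ` {a..b})"
    by (rule bounded_subset[of "{g a..g b}"]) (use mono in \<open>auto simp: mono_def\<close>)
  then have "bounded (F ` ?C)"
    by (intro bounded_uniformly_continuous_image F(1)) auto
  then obtain B where B: "\<And>s. s \<in> ?C \<Longrightarrow> \<bar>F s\<bar> \<le> B"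
    unfolding bounded_iff by auto
  have gC: "t \<in> {a..b} \<Longrightarrow> g t \<in> ?C" for t
    using closure_subset[of "g ` {a..b}"] by auto
  have eq: "indicator (ico g a b x y) t *\<^sub>R f t =
      indicator (ico g a b x y) t *\<^sub>R (indicator ?C (g t) *\<^sub>R F (g t))" for t
    using ico(2) F(2) gC by (auto simp: indicator_def)
  have "emeasure (ls_measure g) (ico g a b x y) \<le> emeasure (ls_measure g) {a..<max a (b + 1)}"
    using ico(2) by (intro emeasure_mono) auto
  also have "\<dots> < \<infinity>" by (subst emeasure_ls_measure[OF g]) auto
  finally have fin: "emeasure (ls_measure g) (ico g a b x y) < \<infinity>" .
  have "integrable (ls_measure g)
      (\<lambda>t. indicator (ico g a b x y) t *\<^sub>R (indicator ?C (g t) *\<^sub>R F (g t)))"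
  proof (rule integrableI_bounded_set_indicator[where B=B])
    show "(\<lambda>t. indicator ?C (g t) *\<^sub>R F (g t)) \<in> borel_measurable (ls_measure g)"
      using measurable_compose[OF \<open>g \<in> borel_measurable borel\<close> Fm]
      by (simp cong: measurable_cong_sets)
    show "AE t in ls_measure g. t \<in> ico g a b x y \<longrightarrow> norm (indicator ?C (g t) *\<^sub>R F (g t)) \<le> B"
      using ico(2) B gC by (intro AE_I2) (auto simp: indicator_def)
  qed (use ico fin in auto)
  then show ?thesis unfolding set_integrable_def eq .
qed

end

(*
  If h is nowhere zero on [t1,t2)^g and takes both signs there, take the last point w up to which
  it keeps its initial sign. Left continuity of h excludes a change of sign at w itself, so the
  sign changes immediately after w. This is impossible where g is continuous, and at a jump of g
  it makes w a root of type II or w^+ a root of type I. If instead h keeps one sign, the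
  vanishing integral makes [t1,t2)^g a null set, although its measure is positive.
*)
theory Submission
  imports Defs
begin

section \<open>Right-hand limits and atoms of a derivator\<close>

lemma right_lim_le_derivator:
  assumes g: "derivator g" and "t < y"
  shows "right_lim g t \<le> g y"
proof (rule tendsto_upperbound[OF tendsto_right_lim_derivator[OF g]])
  have "\<forall>\<^sub>F s in at_right t. s < y"
    using \<open>t < y\<close> by (auto simp: eventually_at_right)
  then show "\<forall>\<^sub>F s in at_right t. g s \<le> g y"
    by eventually_elim (use g in \<open>auto simp: derivator_def mono_def\<close>)
qed auto

lemma le_right_lim_derivator:
  assumes g: "derivator g"
    and ge: "\<And>y. t < y \<Longrightarrow> y \<le> d \<Longrightarrow> c \<le> g y" and "t < d"
  shows "c \<le> right_lim g t"
proof (rule tendsto_lowerbound[OF tendsto_right_lim_derivator[OF g]])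
  show "\<forall>\<^sub>F s in at_right t. c \<le> g s"
    using \<open>t < d\<close> ge unfolding eventually_at_right[OF \<open>t < d\<close>] by (intro exI[of _ d]) auto
qed auto

text \<open>Continuity from above: \<open>{p}\<close> is the intersection of the decreasing
  intervals \<open>{p..<d n}\<close>, whose measures \<open>g (d n) - g p\<close> converge because
  \<open>d n\<close> tends to \<open>p\<close> strictly from the right.\<close>

lemma emeasure_ls_measure_singleton:
  assumes g: "derivator g"
  shows "emeasure (ls_measure g) {p} = ennreal (right_lim g p - g p)"
proof -
  define d where "d n = p + inverse (real (Suc n))" for n
  have "d \<longlonglongrightarrow> p + 0"
    unfolding d_def by (intro tendsto_add tendsto_const LIMSEQ_inverse_real_of_nat)
  then have lim_d: "d \<longlonglongrightarrow> p" by simp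
  have gt: "p < d n" for n by (simp add: d_def)
  have "filterlim d (at_right p) sequentially"
    using lim_d gt gt[THEN less_imp_neq] by (simp add: filterlim_at eq_commute[of _ p])
  then have "(\<lambda>n. g (d n)) \<longlonglongrightarrow> right_lim g p"
    by (rule filterlim_compose[OF tendsto_right_lim_derivator[OF g]])
  then have "(\<lambda>n. ennreal (g (d n) - g p)) \<longlonglongrightarrow> ennreal (right_lim g p - g p)"
    by (intro tendsto_ennrealI tendsto_diff tendsto_const)
  then have 1: "(\<lambda>n. emeasure (ls_measure g) {p..<d n}) \<longlonglongrightarrow> ennreal (right_lim g p - g p)"
    using gt by (simp add: emeasure_ls_measure[OF g] less_imp_le)
  have "(\<lambda>n. emeasure (ls_measure g) {p..<d n}) \<longlonglongrightarrow> emeasure (ls_measure g) (\<Inter>n. {p..<d n})"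
  proof (rule Lim_emeasure_decseq)
    have "d (Suc n) \<le> d n" for n
      unfolding d_def by (intro add_left_mono le_imp_inverse_le) auto
    then show "decseq (\<lambda>n. {p..<d n})"
      by (intro decseq_SucI ivl_subset[THEN iffD2] disjI2) auto
  qed (use gt in \<open>auto simp: emeasure_ls_measure[OF g] less_imp_le\<close>)
  moreover have "(\<Inter>n. {p..<d n}) = {p}"
  proof
    show "(\<Inter>n. {p..<d n}) \<subseteq> {p}"
    proof
      fix x assume "x \<in> (\<Inter>n. {p..<d n})"
      then have x: "p \<le> x" "\<And>n. x \<le> d n" by (auto intro: less_imp_le)
      have "x \<le> p" by (rule LIMSEQ_le_const[OF lim_d]) (use x in auto)
      then show "x \<in> {p}" using x by simp
    qed
  qed (use gt in auto)
  ultimately show ?thesis using 1 LIMSEQ_unique by simp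
qed

section \<open>Continuity and sign changes of functions in \<open>UC\<close>\<close>

text \<open>Closeness in \<open>UC\<close> is measured through \<open>g\<close>, so \<open>f\<close>
  inherits continuity from \<open>g\<close> along any filter: from the left always, from the right
  away from jumps.\<close>

lemma UC_tendsto:
  assumes f: "f \<in> UC g a b" and t: "t \<in> {a..b}"
    and lim: "(g \<longlongrightarrow> g t) F" and ev: "\<forall>\<^sub>F s in F. s \<in> {a..b}"
  shows "(f \<longlongrightarrow> f t) F"
proof (rule tendstoI)
  fix e :: real assume "e > 0"
  then obtain d where "d > 0"
    and d: "\<And>u v. u \<in> {a..b} \<Longrightarrow> v \<in> {a..b} \<Longrightarrow> \<bar>g u - g v\<bar> < d \<Longrightarrow> \<bar>f u - f v\<bar> < e"
    using f unfolding UC_def by blast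
  show "\<forall>\<^sub>F s in F. dist (f s) (f t) < e"
    using ev tendstoD[OF lim \<open>d > 0\<close>]
    by eventually_elim (use d t in \<open>auto simp: dist_real_def\<close>)
qed

text \<open>An intermediate value theorem: one-sided continuity of \<open>f\<close> can fail only
  from the right at a jump of \<open>g\<close>, so zero can be skipped only there.\<close>

lemma UC_sign_change:
  assumes g: "derivator g" and f: "f \<in> UC g a b"
    and uv: "a \<le> u" "u < v" "v \<le> b" and sgn: "f u * f v < 0"
  obtains w where "w \<in> {u..v}" "f w = 0"
  | w where "w \<in> {u..<v}" "w \<in> jumps g" "right_lim f w = 0 \<or> f w * right_lim f w < 0"
proof (rule ccontr)
  note rootI = that(1) and rootII = that(2)
  assume neg: "\<not> thesis"
  have nz: "f w \<noteq> 0" if "w \<in> {u..v}" for w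
    using neg rootI[OF that] by blast
  have nj: "f w * right_lim f w > 0" if "w \<in> {u..<v}" "w \<in> jumps g" for w
    using neg rootII[OF that] nz[of w] that(1)
    by (cases "f w * right_lim f w" "0::real" rule: linorder_cases) auto
  \<comment> \<open>The factor \<open>f u\<close> treats both initial signs at once. Quantifying
    over all of \<open>{u..z}\<close> makes \<open>S\<close> an initial segment, so every point from
    \<open>u\<close> up to its supremum has the initial sign.\<close>
  define S where "S = {z \<in> {u..v}. \<forall>y \<in> {u..z}. f u * f y > 0}"
  define w where "w = Sup S"
  have uS: "u \<in> S" using uv nz[of u] by (auto simp: S_def simp flip: power2_eq_square)
  have bdd: "bdd_above S" by (rule bdd_aboveI[of _ v]) (auto simp: S_def)
  have uw: "u \<le> w" unfolding w_def using uS bdd by (rule cSup_upper)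
  have wv: "w \<le> v" unfolding w_def using uS by (intro cSup_least) (auto simp: S_def)
  have below: "f u * f y > 0" if "u \<le> y" "y < w" for y
  proof -
    obtain z where "z \<in> S" "y < z"
      using uS less_cSupD[of S y] \<open>y < w\<close> by (auto simp: w_def)
    then show ?thesis using \<open>u \<le> y\<close> by (auto simp: S_def)
  qed
  \<comment> \<open>The left limit only gives \<open>0 \<le> f u * f w\<close>; \<open>nz\<close>
    makes it strict. If \<open>u = w\<close>, there are no points of \<open>{u..v}\<close> to the
    left, and \<open>u \<in> S\<close> is used instead.\<close>
  have at_w: "f u * f w > 0"
  proof (cases "u = w")
    case True
    then show ?thesis using uS by (auto simp: S_def)
  next
    case False
    then have "u < w" using uw by simp
    have ev: "\<forall>\<^sub>F s in at_left w. u < s \<and> s < w"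
      using \<open>u < w\<close> unfolding eventually_at_left[OF \<open>u < w\<close>] by blast
    have "(f \<longlongrightarrow> f w) (at_left w)"
    proof (rule UC_tendsto[OF f])
      show "(g \<longlongrightarrow> g w) (at_left w)"
        using g by (simp add: derivator_def continuous_within)
      show "\<forall>\<^sub>F s in at_left w. s \<in> {a..b}"
        using ev by eventually_elim (use uv wv in auto)
    qed (use uv uw wv in auto)
    then have "((\<lambda>s. f u * f s) \<longlongrightarrow> f u * f w) (at_left w)" by (intro tendsto_intros)
    moreover have "\<forall>\<^sub>F s in at_left w. 0 \<le> f u * f s"
      using ev by eventually_elim (use below in \<open>auto intro: less_imp_le\<close>)
    ultimately have "0 \<le> f u * f w" by (rule tendsto_lowerbound) auto
    then show ?thesis using nz[of u] nz[of w] uw wv uv by (auto simp: less_le)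
  qed
  have "w < v" using at_w sgn wv by (cases "w = v") auto
  have lim: "(f \<longlongrightarrow> right_lim f w) (at_right w)"
    using uv uw \<open>w < v\<close> by (intro tendsto_right_lim_UC[OF g f]) auto
  \<comment> \<open>The sign passes to the right limit: at a jump by the assumed absence of roots
    (\<open>nj\<close>), elsewhere because the right limit is \<open>f w\<close>.\<close>
  have "f w * right_lim f w > 0"
  proof (cases "w \<in> jumps g")
    case True
    then show ?thesis using nj uw \<open>w < v\<close> by auto
  next
    case False
    have "right_lim g w = g w"
      using False le_right_lim_derivator[OF g, of w "w + 1" "g w"] g
      by (auto simp: jumps_def derivator_def mono_def)
    then have "(g \<longlongrightarrow> g w) (at_right w)" using tendsto_right_lim_derivator[OF g, of w] by simp
    moreover have "\<forall>\<^sub>F s in at_right w. s \<in> {a..b}"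
      using uv uw \<open>w < v\<close> unfolding eventually_at_right[OF \<open>w < v\<close>]
      by (intro exI[of _ v]) auto
    ultimately have "(f \<longlongrightarrow> f w) (at_right w)"
      using uv uw wv by (intro UC_tendsto[OF f]) auto
    then have "right_lim f w = f w" using lim tendsto_unique trivial_limit_at_right_real by blast
    then show ?thesis using nz[of w] uw wv by (auto simp flip: power2_eq_square)
  qed
  with at_w have "f u * right_lim f w > 0"
    by (auto simp: zero_less_mult_iff)
  moreover have "((\<lambda>s. f u * f s) \<longlongrightarrow> f u * right_lim f w) (at_right w)"
    using lim by (intro tendsto_intros)
  ultimately have "\<forall>\<^sub>F s in at_right w. f u * f s > 0" by (rule order_tendstoD(1)[rotated])
  then obtain r where r: "r > w" "\<And>y. w < y \<Longrightarrow> y < r \<Longrightarrow> f u * f y > 0"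
    unfolding eventually_at_right[OF \<open>w < v\<close>] by blast
  \<comment> \<open>This \<open>z\<close> lies beyond \<open>w\<close>, below \<open>v\<close> and
    inside the right neighbourhood of constant sign, so \<open>S\<close> reaches past its
    supremum.\<close>
  obtain z where z: "w < z" "z < r" "z < v"
    using dense[of w "min r v"] r(1) \<open>w < v\<close> by auto
  have "f u * f y > 0" if "y \<in> {u..z}" for y
    using that below[of y] at_w r(2)[of y] z by (cases y w rule: linorder_cases) auto
  then have "z \<in> S" using z uw by (auto simp: S_def)
  then have "z \<le> w" unfolding w_def using bdd by (rule cSup_upper)
  then show False using z by simp
qed

section \<open>Positivity of measures and integrals\<close>

lemma ext_plus_derivator_le:
  assumes g: "derivator g" and p: "p \<in> ivl_plus g a b"
  shows "ext_plus g p \<le> g b"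
  using p right_lim_le_derivator[OF g] g
  by (auto simp: ivl_plus_def derivator_def mono_def)

text \<open>If \<open>x\<close> is \<open>PtPlus s\<close>, no point of \<open>{a..b}\<close> need
  attain the value \<open>right_lim g s\<close>. Points slightly to the right of \<open>s\<close>
  serve instead: monotonicity gives the lower bound and convergence the strict upper one.\<close>

lemma ico_nonempty:
  assumes g: "derivator g" and x: "x \<in> ivl_plus g a b" and less: "less_g g x y"
  shows "ico g a b x y \<noteq> {}"
proof (cases x)
  case (Pt s)
  then have "s \<in> ico g a b x y" using x less by (auto simp: ico_def less_g_def ivl_plus_def)
  then show ?thesis by blast
next
  case (PtPlus s)
  then have s: "a \<le> s" "s < b" "right_lim g s < ext_plus g y"
    using x less by (auto simp: less_g_def ivl_plus_def)
  have "\<forall>\<^sub>F z in at_right s. g z < ext_plus g y"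
    by (rule order_tendstoD(2)[OF tendsto_right_lim_derivator[OF g] s(3)])
  then obtain r where r: "r > s" "\<And>z. s < z \<Longrightarrow> z < r \<Longrightarrow> g z < ext_plus g y"
    unfolding eventually_at_right[OF s(2)] by blast
  obtain z where "s < z" "z < r" "z < b" using dense[of s "min r b"] r(1) s by auto
  then have "z \<in> ico g a b x y"
    using PtPlus s r(2) right_lim_le_derivator[OF g] by (auto simp: ico_def)
  then show ?thesis by blast
qed

text \<open>
  At the supremum \<open>c\<close> of the set, either \<open>c\<close> belongs to it and is an atom because \<open>g\<close> jumps past
  the upper bound there, or \<open>g c\<close> has reached the upper bound and the set contains some \<open>{z..<c}\<close>.
\<close>

lemma emeasure_ico_pos:
  assumes g: "derivator g" and x: "x \<in> ivl_plus g a b" and y: "y \<in> ivl_plus g a b"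
    and less: "less_g g x y"
  shows "emeasure (ls_measure g) (ico g a b x y) > 0"
proof -
  let ?E = "ico g a b x y"
  have mono: "mono g" using g by (simp add: derivator_def)
  obtain z where z: "z \<in> ?E" using ico_nonempty[OF g x less] by blast
  have bdd: "bdd_above ?E" by (rule bdd_aboveI[of _ b]) (auto simp: ico_def)
  define c where "c = Sup ?E"
  have zc: "z \<le> c" unfolding c_def using z bdd by (rule cSup_upper)
  have cb: "c \<le> b" unfolding c_def using z by (intro cSup_least) (auto simp: ico_def)
  have gzc: "g z \<le> g c" using zc mono by (simp add: mono_def)
  obtain A where "A \<in> sets borel" "A \<subseteq> ?E" "emeasure (ls_measure g) A > 0"
  proof (cases "c \<in> ?E")
    case True
    then have gc: "g c < ext_plus g y" by (simp add: ico_def)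
    \<comment> \<open>The upper bound \<open>ext_plus g y\<close> is at most \<open>g b\<close>, so
      \<open>c\<close> cannot be \<open>b\<close> and there is room for a right limit.\<close>
    then have "c < b" using cb ext_plus_derivator_le[OF g y] by (cases "c = b") auto
    have "ext_plus g y \<le> right_lim g c"
    proof (rule le_right_lim_derivator[OF g _ \<open>c < b\<close>])
      fix s assume s: "c < s" "s \<le> b"
      \<comment> \<open>Beyond \<open>c\<close> the lower bound persists by monotonicity, so leaving
        \<open>?E\<close> means that \<open>g\<close> has reached the upper bound.\<close>
      then have "s \<notin> ?E" using bdd cSup_upper[of s ?E] by (auto simp: c_def)
      moreover have "g c \<le> g s" using s mono by (simp add: mono_def)
      ultimately show "ext_plus g y \<le> g s" using s True by (auto simp: ico_def)
    qed
    then have "emeasure (ls_measure g) {c} > 0"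
      using gc by (simp add: emeasure_ls_measure_singleton[OF g] ennreal_less_zero_iff)
    then show ?thesis using True by (intro that[of "{c}"]) auto
  next
    case False
    then have gc: "ext_plus g y \<le> g c" using z zc cb gzc by (auto simp: ico_def)
    then have "g z < g c" using z by (auto simp: ico_def)
    have "s \<in> ?E" if s: "s \<in> {z..<c}" for s
    proof -
      obtain r where "r \<in> ?E" "s < r"
        using s z less_cSupD[of ?E s] by (auto simp: c_def)
      moreover have "g z \<le> g s" "g s \<le> g r"
        using s \<open>s < r\<close> mono by (auto simp: mono_def)
      ultimately show ?thesis using z s by (auto simp: ico_def)
    qed
    moreover have "emeasure (ls_measure g) {z..<c} > 0"
      using zc \<open>g z < g c\<close> by (simp add: emeasure_ls_measure[OF g] ennreal_less_zero_iff)
    ultimately show ?thesis by (intro that[of "{z..<c}"]) auto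
  qed
  then show ?thesis
    using emeasure_mono[of A ?E "ls_measure g"] ico_borel[OF g] by (auto intro: less_le_trans)
qed

text \<open>A nonnegative integrand with zero integral vanishes almost everywhere, which would make
  \<open>A\<close> a null set.\<close>

lemma set_lebesgue_integral_pos:
  fixes f :: "'a \<Rightarrow> real"
  assumes int: "set_integrable M A f" and A: "A \<in> sets M" "emeasure M A > 0"
    and pos: "\<And>x. x \<in> A \<Longrightarrow> f x > 0"
  shows "set_lebesgue_integral M A f > 0"
proof -
  let ?k = "\<lambda>x. indicator A x *\<^sub>R f x"
  have int': "integrable M ?k" using int by (simp add: set_integrable_def)
  have nn: "AE x in M. 0 \<le> ?k x" using pos by (auto simp: indicator_def less_imp_le)
  have "integral\<^sup>L M ?k \<noteq> 0"
  proof
    assume "integral\<^sup>L M ?k = 0"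
    then have "AE x in M. ?k x = 0" using integral_nonneg_eq_0_iff_AE[OF int' nn] by simp
    then have "AE x in M. x \<notin> A"
      by eventually_elim (use pos in \<open>fastforce simp: indicator_def\<close>)
    then have "emeasure M A = 0" using A(1) AE_iff_null_sets by auto
    then show False using A(2) by simp
  qed
  then show ?thesis
    using integral_nonneg_AE[OF nn] by (simp add: set_lebesgue_integral_def less_le)
qed

section \<open>Roots from a vanishing integral\<close>

theorem proposition4p4:
  fixes g h :: "real \<Rightarrow> real" and a b :: real and t1 t2 :: point
  assumes "a < b"
    and "derivator g"
    and "h \<in> UC g a b"
    and "t1 \<in> ivl_plus g a b" and "t2 \<in> ivl_plus g a b"
    and "less_g g t1 t2"
    and "set_lebesgue_integral (ls_measure g) (ico g a b t1 t2) h = 0"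
  shows "\<exists>t \<in> ico_plus g a b t1 t2. root_I g a b h t \<or> root_II g a b h t"
proof -
  note g = \<open>derivator g\<close> and h = \<open>h \<in> UC g a b\<close>
  let ?E = "ico g a b t1 t2"
  have mono: "mono g" using g by (simp add: derivator_def)
  have Pt_in: "Pt w \<in> ico_plus g a b t1 t2" if "w \<in> ?E" for w
    using that by (auto simp: ico_def ico_plus_def ivl_plus_def)
  obtain c where c: "c \<in> ?E" using ico_nonempty[OF g] assms by blast
  \<comment> \<open>Otherwise \<open>h c * h y\<close> would be positive throughout
    \<open>?E\<close>, a set of positive measure, while its integral is \<open>h c\<close> times
    zero.\<close>
  have "\<exists>y \<in> ?E. h c * h y \<le> 0"
  proof (rule ccontr)
    assume "\<not> ?thesis"
    then have "set_lebesgue_integral (ls_measure g) ?E (\<lambda>y. h c * h y) > 0"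
      using set_integrable_UC[OF g h] ico_borel[OF g] emeasure_ico_pos[OF g] assms
      by (intro set_lebesgue_integral_pos) auto
    then show False using assms by simp
  qed
  then obtain d where d: "d \<in> ?E" "h c * h d \<le> 0" by blast
  show ?thesis
  proof (cases "h c * h d = 0")
    case True
    then obtain w where "w \<in> ?E" "h w = 0" using c d by auto
    then show ?thesis
      using Pt_in by (intro bexI[of _ "Pt w"]) (auto simp: root_I_def ico_plus_def)
  next
    case False
    define u v where "u = min c d" and "v = max c d"
    have uv: "u \<in> ?E" "v \<in> ?E" using c d by (auto simp: u_def v_def min_def max_def)
    have "h c * h d < 0" using False d(2) by linarith
    then have sgn: "h u * h v < 0" by (auto simp: u_def v_def min_def max_def mult.commute)
    then have "u \<noteq> v" by (auto simp: not_less)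
    then have ord: "a \<le> u" "u < v" "v \<le> b"
      using uv by (auto simp: ico_def u_def v_def min_def max_def)
    have between: "w \<in> ?E" if "w \<in> {u..v}" for w
    proof -
      have "g u \<le> g w" "g w \<le> g v" using that mono by (auto simp: mono_def)
      then show ?thesis using uv that by (auto simp: ico_def)
    qed
    from UC_sign_change[OF g h ord sgn] show ?thesis
    proof cases
      case (1 w)
      then show ?thesis using Pt_in between
        by (intro bexI[of _ "Pt w"]) (auto simp: root_I_def ico_plus_def)
    next
      case (2 w)
      then have wE: "w \<in> ?E" and w: "w \<in> jumps g \<inter> {a..<b}" using between ord by auto
      from 2(3) show ?thesis
      proof
        assume "right_lim h w = 0"
        \<comment> \<open>Since \<open>w < v\<close>, the right limit stays below the upper bound at
          \<open>t2\<close>; since \<open>w\<close> is a jump, it exceeds \<open>g w\<close> and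
          hence the lower bound. Thus \<open>PtPlus w\<close> lies in
          \<open>ico_plus g a b t1 t2\<close>.\<close>
        moreover have "right_lim g w \<le> g v" using 2 right_lim_le_derivator[OF g] by auto
        ultimately show ?thesis using wE w uv
          by (intro bexI[of _ "PtPlus w"])
             (auto simp: root_I_def ico_plus_def ico_def ivl_plus_def jumps_def)
      next
        assume "h w * right_lim h w < 0"
        then show ?thesis using Pt_in[OF wE] w
          by (intro bexI[of _ "Pt w"]) (auto simp: root_II_def)
      qed
    qed
  qed
qed

end
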